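(* Let $H$ be a real or complex inner product space (not necessarily complete) with $\dim H\geq 3$ (possibly infinite). Let $\phi\colon P(H)\to P(H)$ be a bijective map which satisfies $$[u]\perp[v]\iff\phi([u])\perp\phi([v])\quad([u],[v]\in P(H)).$$ Then $\phi$ is a Wigner symmetry; that is, there exists a bijective isometry $U\colon H\to H$, which is linear if $H$ is real and which is linear or conjugate-linear if $H$ is complex, such that $\phi([v])=[Uv]$ for every $[v]\in P(H)$.
   Context: $P(H)$ is the set of all one-dimensional subspaces (lines) of $H$; for $0\neq v\in H$, $[v]$ is the line generated by $v$. $[u]\perp[v]$ means $\langle u,v\rangle=0$. *)

theory Defs
  imports "HOL-Analysis.Analysis"
begin

text \<open>The complex analogue of \<^class>\<open>real_inner\<close>; neither class asks for completeness.
  The inner product is linear in the first argument. Everything inherited from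
  \<^class>\<open>real_normed_vector\<close> is determined by \<open>scaleC\<close> and \<open>cinner\<close>: real scalars act as complex
  ones, the norm is the one induced by the inner product, and the metric and the topology come
  from the norm.\<close>

class complex_inner = real_normed_vector +
  fixes scaleC :: "complex \<Rightarrow> 'a \<Rightarrow> 'a" (infixr \<open>*\<^sub>C\<close> 75)
    and cinner :: "'a \<Rightarrow> 'a \<Rightarrow> complex"
  assumes scaleC_add_right: "a *\<^sub>C (x + y) = a *\<^sub>C x + a *\<^sub>C y"
    and scaleC_add_left: "(a + b) *\<^sub>C x = a *\<^sub>C x + b *\<^sub>C x"
    and scaleC_scaleC: "a *\<^sub>C b *\<^sub>C x = (a * b) *\<^sub>C x"
    and scaleC_one: "1 *\<^sub>C x = x"
    and scaleR_eq_scaleC: "r *\<^sub>R x = complex_of_real r *\<^sub>C x"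
    and cinner_commute: "cinner x y = cnj (cinner y x)"
    and cinner_add_left: "cinner (x + y) z = cinner x z + cinner y z"
    and cinner_scaleC_left: "cinner (a *\<^sub>C x) y = a * cinner x y"
    and cinner_ge_zero: "0 \<le> Re (cinner x x)"
    and cinner_eq_zero_iff: "cinner x x = 0 \<longleftrightarrow> x = 0"
    and norm_eq_sqrt_cinner: "norm x = sqrt (Re (cinner x x))"

lemma vector_space_scaleC: "vector_space (scaleC :: complex \<Rightarrow> 'a::complex_inner \<Rightarrow> 'a)"
  by unfold_locales
    (simp_all add: scaleC_add_right scaleC_add_left scaleC_scaleC scaleC_one)

text \<open>The notions below take the scalar multiplication (and the inner product) as arguments, so
  that they serve real and complex spaces alike.\<close>

text \<open>The library's \<open>vector_space.dim\<close> is \<open>0\<close> on infinite-dimensional spaces.\<close>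

definition space_dim :: "('k::field \<Rightarrow> 'a::ab_group_add \<Rightarrow> 'a) \<Rightarrow> enat" where
  "space_dim s =
     (if \<exists>B. finite B \<and> module.span s B = UNIV then enat (vector_space.dim s UNIV) else \<infinity>)"

definition line :: "('k::field \<Rightarrow> 'a::ab_group_add \<Rightarrow> 'a) \<Rightarrow> 'a \<Rightarrow> 'a set" where
  "line s v = module.span s {v}"

definition lines :: "('k::field \<Rightarrow> 'a::ab_group_add \<Rightarrow> 'a) \<Rightarrow> 'a set set" where
  "lines s = {L. module.subspace s L \<and> vector_space.dim s L = 1}"

text \<open>The choice of generators is immaterial; see \<open>line_perp_line_real\<close> and
  \<open>line_perp_line_complex\<close> below.\<close>

definition line_perp ::
    "('k::field \<Rightarrow> 'a::ab_group_add \<Rightarrow> 'a) \<Rightarrow> ('a \<Rightarrow> 'a \<Rightarrow> 'k) \<Rightarrow> 'a set \<Rightarrow> 'a set \<Rightarrow> bool" where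
  "line_perp s ip L M \<longleftrightarrow>
     (\<exists>u v. u \<noteq> 0 \<and> v \<noteq> 0 \<and> L = line s u \<and> M = line s v \<and> ip u v = 0)"

lemma lines_eq:
  assumes "vector_space s"
  shows "lines s = {line s v | v. v \<noteq> 0}"
proof -
  interpret vector_space s by fact
  have "\<exists>v. v \<noteq> 0 \<and> L = span {v}" if L: "subspace L" "dim L = 1" for L
  proof -
    obtain B where B: "B \<subseteq> L" "independent B" "L \<subseteq> span B" "card B = dim L"
      using basis_exists by blast
    then obtain v where v: "B = {v}" using L(2) by (auto simp: card_1_singleton_iff)
    have "v \<noteq> 0" using B(2) v dependent_zero by blast
    moreover have "L = span {v}" using B v span_minimal[OF B(1) L(1)] by auto
    ultimately show ?thesis by blast
  qed
  moreover have "dim (span {v}) = 1" if "v \<noteq> 0" for v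
    using that by (simp add: dim_span dim_eq_card_independent)
  ultimately show ?thesis unfolding lines_def line_def by (auto simp: subspace_span)
qed

lemma line_eqD:
  assumes "vector_space s" "u \<noteq> 0" "line s u = line s v"
  shows "\<exists>c. c \<noteq> 0 \<and> u = s c v"
proof -
  interpret vector_space s by fact
  have "u \<in> span {v}" using assms(3) span_base[of u "{u}"] by (simp add: line_def)
  then obtain c where "u = s c v" by (auto simp: span_singleton)
  then show ?thesis using assms(2) by auto
qed

lemma line_perp_line_real:
  fixes u v :: "'a::real_inner"
  assumes "u \<noteq> 0" "v \<noteq> 0"
  shows "line_perp scaleR inner (line scaleR u) (line scaleR v) \<longleftrightarrow> inner u v = 0"
proof
  assume "line_perp scaleR inner (line scaleR u) (line scaleR v)"
  then obtain x y where "line scaleR u = line scaleR x" "line scaleR v = line scaleR y"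
    "inner x y = 0" unfolding line_perp_def by blast
  then show "inner u v = 0"
    using line_eqD[OF real_vector.vector_space_axioms, of u x] line_eqD[OF real_vector.vector_space_axioms, of v y] assms
    by auto
qed (use assms in \<open>auto simp: line_perp_def\<close>)

lemma cinner_scaleC_right: "cinner x (a *\<^sub>C y) = cnj a * cinner x y"
  by (metis cinner_commute cinner_scaleC_left complex_cnj_mult)

lemma line_perp_line_complex:
  fixes u v :: "'a::complex_inner"
  assumes "u \<noteq> 0" "v \<noteq> 0"
  shows "line_perp scaleC cinner (line scaleC u) (line scaleC v) \<longleftrightarrow> cinner u v = 0"
proof
  assume "line_perp scaleC cinner (line scaleC u) (line scaleC v)"
  then obtain x y where "line scaleC u = line scaleC x" "line scaleC v = line scaleC y"
    "cinner x y = 0" unfolding line_perp_def by blast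
  then show "cinner u v = 0"
    using line_eqD[OF vector_space_scaleC, of u x] line_eqD[OF vector_space_scaleC, of v y] assms
    by (auto simp: cinner_scaleC_left cinner_scaleC_right)
qed (use assms in \<open>auto simp: line_perp_def\<close>)

definition isometry :: "('a::metric_space \<Rightarrow> 'b::metric_space) \<Rightarrow> bool" where
  "isometry U \<longleftrightarrow> (\<forall>x y. dist (U x) (U y) = dist x y)"

definition conjugate_linear :: "('a::complex_inner \<Rightarrow> 'b::complex_inner) \<Rightarrow> bool" where
  "conjugate_linear U \<longleftrightarrow>
     (\<forall>x y. U (x + y) = U x + U y) \<and> (\<forall>c x. U (c *\<^sub>C x) = cnj c *\<^sub>C U x)"

definition real_Wigner_symmetry :: "('a::real_inner set \<Rightarrow> 'a set) \<Rightarrow> bool" where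
  "real_Wigner_symmetry \<phi> \<longleftrightarrow>
     (\<exists>U :: 'a \<Rightarrow> 'a. bij U \<and> isometry U \<and> linear U \<and>
        (\<forall>v. v \<noteq> 0 \<longrightarrow> \<phi> (line scaleR v) = line scaleR (U v)))"

definition complex_Wigner_symmetry :: "('a::complex_inner set \<Rightarrow> 'a set) \<Rightarrow> bool" where
  "complex_Wigner_symmetry \<phi> \<longleftrightarrow>
     (\<exists>U :: 'a \<Rightarrow> 'a. bij U \<and> isometry U \<and>
        (Vector_Spaces.linear scaleC scaleC U \<or> conjugate_linear U) \<and>
        (\<forall>v. v \<noteq> 0 \<longrightarrow> \<phi> (line scaleC v) = line scaleC (U v)))"

end

theory Submission
  imports Defs
begin

text \<open>Fix unit vectors \<open>e\<close> and \<open>e'\<close> with \<open>\<phi> [e] = [e']\<close>. Every \<open>x \<perp> e\<close> has a unique \<open>g x \<perp> e'\<close>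
  with \<open>\<phi> [e + x] = [e' + g x]\<close>, and then \<open>\<phi> [x] = [g x]\<close> for \<open>x \<noteq> 0\<close>. The span of two vectors is
  its own biorthogonal complement, so \<open>\<phi>\<close> preserves collinearity of lines; applied to
  \<open>e + x + y = (e + x) + y = (e + y) + x\<close> this makes \<open>g\<close> additive, and \<open>g\<close> is semilinear with
  respect to some ring endomorphism \<open>\<sigma>\<close> of the scalars. Since \<open>e + x \<perp> e + y\<close> means
  \<open>\<langle>x, y\<rangle> = -1\<close>, the map \<open>g\<close> preserves the relation \<open>\<langle>x, y\<rangle> = -1\<close>, and rescaling gives
  \<open>\<langle>g x, g y\<rangle> = \<sigma> \<langle>x, y\<rangle>\<close>. Hence \<open>\<sigma>\<close> commutes with conjugation, which forces it to be the identity
  or complex conjugation, and \<open>U (a e + x) = \<sigma> a e' + g x\<close> is the required isometry.\<close>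

section \<open>Hermitian spaces\<close>

text \<open>One setting for both scalar fields: \<open>J\<close> is the identity over the reals and
  \<open>cnj\<close> over the complex numbers. No order on \<open>'k\<close> is available here, so
  \<open>unit_multiple\<close> takes the place of dividing by the norm.\<close>

locale hermitian_space = vector_space s
  for s :: "'k::field \<Rightarrow> 'a::ab_group_add \<Rightarrow> 'a" +
  fixes J :: "'k \<Rightarrow> 'k" and ip :: "'a \<Rightarrow> 'a \<Rightarrow> 'k"
  assumes J_add: "J (a + b) = J a + J b"
    and J_mult: "J (a * b) = J a * J b"
    and J_J: "J (J a) = a"
    and ip_commute: "ip x y = J (ip y x)"
    and ip_add_left: "ip (x + y) z = ip x z + ip y z"
    and ip_scale_left: "ip (s a x) y = a * ip x y"
    and ip_eq_zero_iff: "ip x x = 0 \<longleftrightarrow> x = 0"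
    and unit_multiple: "x \<noteq> 0 \<Longrightarrow> \<exists>c. ip (s c x) (s c x) = 1"
begin

lemma J_0: "J 0 = 0"
  by (metis J_add add.right_neutral add_left_cancel)

lemma J_1: "J 1 = 1"
  using J_mult[of "J 1" 1] by (simp add: J_J)

lemma ip_add_right: "ip x (y + z) = ip x y + ip x z"
  by (simp add: ip_commute[of x "y + z"] ip_commute[of x y] ip_commute[of x z] ip_add_left J_add)

lemma ip_scale_right: "ip x (s a y) = J a * ip x y"
  by (simp add: ip_commute[of x "s a y"] ip_commute[of x y] ip_scale_left J_mult)

lemma ip_zero_left: "ip 0 x = 0"
  using ip_scale_left[of 0 0 x] by simp

lemma ip_zero_right: "ip x 0 = 0"
  using ip_scale_right[of x 0 0] by (simp add: J_0)

lemma ip_minus_left: "ip (- x) y = - ip x y"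
  using ip_add_left[of x "- x" y] by (simp add: ip_zero_left add_eq_0_iff)

lemma ip_diff_left: "ip (x - y) z = ip x z - ip y z"
  using ip_add_left[of x "- y" z] by (simp add: ip_minus_left)

lemma ip_minus_right: "ip x (- y) = - ip x y"
  using ip_add_right[of x y "- y"] by (simp add: ip_zero_right add_eq_0_iff)

lemma ip_diff_right: "ip x (y - z) = ip x y - ip x z"
  using ip_add_right[of x y "- z"] by (simp add: ip_minus_right)

lemmas ip_simps = ip_add_left ip_add_right ip_scale_left ip_scale_right ip_zero_left ip_zero_right
  ip_minus_left ip_minus_right ip_diff_left ip_diff_right

lemma ip_zero_commute: "ip x y = 0 \<longleftrightarrow> ip y x = 0"
  using ip_commute[of x y] ip_commute[of y x] by (auto simp: J_0)

text \<open>Gram-Schmidt on \<open>p\<close>, \<open>q\<close>, then projection of \<open>r\<close>.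
  The two vectors may be dependent or zero: a quotient by zero is zero, so a vanishing
  \<open>p\<close> or \<open>q1\<close> just contributes nothing.\<close>

lemma orthogonal_part:
  "\<exists>a b. ip (r - (s a p + s b q)) p = 0 \<and> ip (r - (s a p + s b q)) q = 0"
proof -
  define k where "k = ip q p / ip p p"
  define q1 where "q1 = q - s k p"
  have q1: "ip q1 p = 0"
    by (cases "p = 0") (auto simp: q1_def k_def ip_simps ip_eq_zero_iff)
  define b where "b = ip r q1 / ip q1 q1"
  define a where "a = ip r p / ip p p"
  define z where "z = r - (s a p + s b q1)"
  have zp: "ip z p = 0"
    by (cases "p = 0") (auto simp: z_def a_def ip_simps ip_eq_zero_iff q1)
  have zq1: "ip z q1 = 0"
    using q1 ip_zero_commute[of q1 p]
    by (cases "q1 = 0") (auto simp: z_def b_def ip_simps ip_eq_zero_iff)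
  have q: "q = q1 + s k p" by (simp add: q1_def)
  have zq: "ip z q = 0" unfolding q using zq1 zp by (simp add: ip_simps)
  have "z = r - (s (a - b * k) p + s b q)"
    unfolding z_def q by (simp add: scale_left_diff_distrib scale_right_distrib)
  then show ?thesis using zp zq by blast
qed

text \<open>The part of \<open>r\<close> orthogonal to \<open>p\<close> and \<open>q\<close> is
  orthogonal to \<open>r\<close> by assumption, hence to itself, hence zero.\<close>

lemma biorthogonal_pair:
  assumes "\<And>z. ip z p = 0 \<Longrightarrow> ip z q = 0 \<Longrightarrow> ip z r = 0"
  shows "\<exists>a b. r = s a p + s b q"
proof -
  obtain a b where z: "ip (r - (s a p + s b q)) p = 0" "ip (r - (s a p + s b q)) q = 0"
    using orthogonal_part by blast
  with assms have "ip (r - (s a p + s b q)) r = 0" by blast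
  with z have "ip (r - (s a p + s b q)) (r - (s a p + s b q)) = 0"
    by (simp add: ip_diff_right ip_add_right ip_scale_right)
  then have "r = s a p + s b q" by (simp add: ip_eq_zero_iff)
  then show ?thesis by blast
qed

text \<open>The dimension hypothesis enters through this lemma: some vector lies outside the span of
  \<open>u\<close> and \<open>v\<close>, and its orthogonal part is nonzero.\<close>

lemma exists_orthogonal_to_pair:
  assumes "3 \<le> space_dim s"
  shows "\<exists>w. w \<noteq> 0 \<and> ip w u = 0 \<and> ip w v = 0"
proof -
  have "span {u, v} \<noteq> UNIV"
  proof
    assume sp: "span {u, v} = UNIV"
    \<comment> \<open>A finite spanning set selects the branch of \<open>space_dim\<close> given by
      the library dimension, which is then at most 2.\<close>
    have "\<exists>B. finite B \<and> span B = UNIV"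
      by (rule exI[of _ "{u, v}"], rule conjI[OF _ sp]) simp
    then have "3 \<le> enat (dim UNIV)" using assms unfolding space_dim_def by simp
    then have "3 \<le> dim UNIV" by (simp add: numeral_eq_enat)
    moreover have "dim UNIV \<le> card {u, v}"
      using sp by (intro dim_le_card) auto
    moreover have "card {u, v} \<le> 2" by (simp add: card_insert_if)
    ultimately show False by simp
  qed
  then obtain r where r: "r \<notin> span {u, v}" by blast
  obtain a b where z: "ip (r - (s a u + s b v)) u = 0" "ip (r - (s a u + s b v)) v = 0"
    using orthogonal_part by blast
  have "s a u + s b v \<in> span {u, v}"
    by (intro span_add span_scale span_base) auto
  with r have "r - (s a u + s b v) \<noteq> 0" by auto
  with z show ?thesis by blast
qed

end

section \<open>Orthogonality-preserving relations\<close>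

text \<open>\<open>R v w\<close> stands for \<open>\<phi> [v] = [w]\<close> with \<open>v\<close> and \<open>w\<close> nonzero.\<close>

locale orthogonality_relation = hermitian_space s J ip
  for s :: "'k::field \<Rightarrow> 'a::ab_group_add \<Rightarrow> 'a" and J ip +
  fixes R :: "'a \<Rightarrow> 'a \<Rightarrow> bool"
  assumes exists_orthogonal: "\<exists>w. w \<noteq> 0 \<and> ip w u = 0 \<and> ip w v = 0"
    and R_nonzero: "R v w \<Longrightarrow> v \<noteq> 0 \<and> w \<noteq> 0"
    and R_total: "v \<noteq> 0 \<Longrightarrow> \<exists>w. R v w"
    and R_surj: "w \<noteq> 0 \<Longrightarrow> \<exists>v. R v w"
    and R_scale_left: "R v w \<Longrightarrow> c \<noteq> 0 \<Longrightarrow> R (s c v) w"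
    and R_scale_right: "R v w \<Longrightarrow> c \<noteq> 0 \<Longrightarrow> R v (s c w)"
    and R_orthogonal: "R v w \<Longrightarrow> R v' w' \<Longrightarrow> ip v v' = 0 \<longleftrightarrow> ip w w' = 0"
begin

text \<open>Coplanarity is expressed through orthogonality alone: a vector orthogonal to
  \<open>p'\<close> and \<open>q'\<close> is pulled back along \<open>R\<close>, where linearity
  makes it orthogonal to \<open>r\<close>, and is then pushed forward again.\<close>

lemma R_coplanar:
  assumes "R p p'" "R q q'" "R r r'" "r = s a p + s b q"
  shows "\<exists>a b. r' = s a p' + s b q'"
proof (rule biorthogonal_pair)
  fix z' assume z': "ip z' p' = 0" "ip z' q' = 0"
  show "ip z' r' = 0"
  proof (cases "z' = 0")
    case False
    then obtain z where z: "R z z'" using R_surj by blast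
    then have "ip z p = 0" "ip z q = 0" using z' R_orthogonal assms by blast+
    then have "ip z r = 0" using assms by (simp add: ip_simps)
    then show ?thesis using z assms R_orthogonal by blast
  qed (simp add: ip_zero_left)
qed

text \<open>The degenerate plane \<open>p = q = v\<close>: the image of a line is determined up to a
  scalar.\<close>

lemma R_collinear:
  assumes "R v w" "R v w'"
  shows "\<exists>c. w' = s c w"
proof -
  have "v = s 1 v + s 0 v" by simp
  then obtain a b where "w' = s a w + s b w"
    using R_coplanar[OF assms(1) assms(1) assms(2)] by blast
  then show ?thesis by (metis scale_left_distrib)
qed

text \<open>The same biorthogonality argument run from target to source, with \<open>R_total\<close>
  in place of \<open>R_surj\<close>.\<close>

lemma R_collinear_converse:
  assumes "R v w" "R v' w'" "w' = s c w"
  shows "\<exists>c. v' = s c v"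
proof -
  have "\<exists>a b. v' = s a v + s b v"
  proof (rule biorthogonal_pair)
    fix z assume z: "ip z v = 0"
    show "ip z v' = 0"
    proof (cases "z = 0")
      case False
      then obtain z' where z': "R z z'" using R_total by blast
      then have "ip z' w = 0" using z R_orthogonal assms by blast
      then have "ip z' w' = 0" using assms by (simp add: ip_simps)
      then show ?thesis using z' assms R_orthogonal by blast
    qed (simp add: ip_zero_left)
  qed
  then show ?thesis by (metis scale_left_distrib)
qed

end

locale based_orthogonality_relation = orthogonality_relation s J ip R
  for s :: "'k::field \<Rightarrow> 'a::ab_group_add \<Rightarrow> 'a" and J ip R +
  fixes e e'
  assumes R_base: "R e e'" and ip_e: "ip e e = 1" and ip_e': "ip e' e' = 1"
begin

section \<open>The line map in affine charts around \<open>e\<close> and \<open>e'\<close>\<close>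

definition g :: "'a \<Rightarrow> 'a" where
  "g x = (THE y. ip y e' = 0 \<and> R (e + x) (e' + y))"

text \<open>Two representatives of one line differ by a scalar; pairing with \<open>e'\<close> shows
  that it is 1.\<close>

lemma g_unique:
  assumes "ip y e' = 0" "R v (e' + y)" "ip y' e' = 0" "R v (e' + y')"
  shows "y' = y"
proof -
  obtain c where c: "e' + y' = s c (e' + y)" using R_collinear assms by blast
  then have "ip (e' + y') e' = c * ip (e' + y) e'" by (simp add: ip_scale_left)
  then have "c = 1" using assms by (simp add: ip_simps ip_e')
  then show ?thesis using c by simp
qed

text \<open>As \<open>e + x\<close> is not orthogonal to \<open>e\<close>, its image is not
  orthogonal to \<open>e'\<close> and can be rescaled to have component 1 along
  \<open>e'\<close>.\<close>

lemma g_props: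
  assumes x: "ip x e = 0"
  shows "ip (g x) e' = 0 \<and> R (e + x) (e' + g x)"
proof -
  have n: "ip (e + x) e = 1" using x by (simp add: ip_simps ip_e)
  then have "e + x \<noteq> 0" by (auto simp: ip_zero_left)
  then obtain w where w: "R (e + x) w" using R_total by blast
  define a where "a = ip w e'"
  have a: "a \<noteq> 0" using R_orthogonal[OF w R_base] n by (simp add: a_def)
  have "R (e + x) (e' + (s (1 / a) w - e'))" using R_scale_right[OF w, of "1 / a"] a by simp
  moreover have "ip (s (1 / a) w - e') e' = 0" using a by (simp add: ip_simps ip_e' a_def)
  ultimately have "\<exists>!y. ip y e' = 0 \<and> R (e + x) (e' + y)" using g_unique by blast
  then show ?thesis unfolding g_def by (rule theI')
qed

lemma ip_g_e': "ip x e = 0 \<Longrightarrow> ip (g x) e' = 0"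
  and R_add_g: "ip x e = 0 \<Longrightarrow> R (e + x) (e' + g x)"
  using g_props by blast+

lemma g_0: "g 0 = 0"
  using g_unique[of 0 e "g 0"] g_props[of 0] R_base by (simp add: ip_zero_left)

text \<open>The image of \<open>e + x\<close> lies in the plane of \<open>e'\<close> and the image
  \<open>w\<close> of \<open>x\<close>; comparing components along \<open>e'\<close> leaves
  \<open>g x = s b w\<close>. If \<open>b\<close> were 0, then \<open>w\<close> orthogonal to
  \<open>e'\<close> would force \<open>x\<close> orthogonal to \<open>e + x\<close>, hence to
  itself.\<close>

lemma R_g:
  assumes x: "ip x e = 0" and "x \<noteq> 0"
  shows "R x (g x)"
proof -
  obtain w where w: "R x w" using assms R_total by blast
  have we: "ip w e' = 0" using R_orthogonal[OF w R_base] x by simp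
  have "e + x = s 1 e + s 1 x" by simp
  then obtain a b where ab: "e' + g x = s a e' + s b w"
    using R_coplanar[OF R_base w R_add_g[OF x]] by blast
  then have "ip (e' + g x) e' = ip (s a e' + s b w) e'" by simp
  then have "a = 1" using we ip_g_e'[OF x] by (simp add: ip_simps ip_e')
  with ab have b: "g x = s b w" by simp
  have "b \<noteq> 0"
  proof
    assume "b = 0"
    then have "R (e + x) e'" using R_add_g[OF x] b by simp
    then have "ip x (e + x) = 0" using R_orthogonal[OF w] we by blast
    then show False using x assms ip_zero_commute[of x e] by (simp add: ip_simps ip_eq_zero_iff)
  qed
  then show ?thesis using b R_scale_right[OF w] by simp
qed

section \<open>Additivity of \<open>g\<close>\<close>

lemma g_nonzero: "ip x e = 0 \<Longrightarrow> x \<noteq> 0 \<Longrightarrow> g x \<noteq> 0"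
  using R_g R_nonzero by blast

lemma g_independent:
  assumes "ip x e = 0" "ip y e = 0" "x \<noteq> 0" and indep: "\<And>c. y \<noteq> s c x"
    and eq: "s a (g x) = s b (g y)"
  shows "a = 0 \<and> b = 0"
proof -
  have y: "y \<noteq> 0" using indep[of 0] by auto
  have "b = 0"
  proof (rule ccontr)
    assume "b \<noteq> 0"
    then have "g y = s (a / b) (g x)" using eq
      by (metis divide_inverse_commute left_inverse scale_one scale_scale)
    then show False
      using R_collinear_converse[OF R_g R_g] assms y indep by blast
  qed
  then show ?thesis using eq g_nonzero[of x] assms by simp
qed

text \<open>Half of additivity: \<open>e + x + y\<close> lies in the plane of \<open>e + x\<close>
  and \<open>y\<close>, and the component along \<open>e'\<close> fixes the coefficient of
  \<open>e' + g x\<close>.\<close>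

lemma g_add_coplanar:
  assumes x: "ip x e = 0" and y: "ip y e = 0" "y \<noteq> 0"
  shows "\<exists>b. g (x + y) = g x + s b (g y)"
proof -
  have xy: "ip (x + y) e = 0" using x y by (simp add: ip_simps)
  have "e + (x + y) = s 1 (e + x) + s 1 y" by (simp add: add.assoc)
  then obtain a b where ab: "e' + g (x + y) = s a (e' + g x) + s b (g y)"
    using R_coplanar[OF R_add_g[OF x] R_g[OF y] R_add_g[OF xy]] by blast
  then have "ip (e' + g (x + y)) e' = ip (s a (e' + g x) + s b (g y)) e'" by simp
  then have "a = 1" using ip_g_e' x y xy by (simp add: ip_simps ip_e')
  with ab have "g (x + y) = g x + s b (g y)" by (simp add: add.assoc)
  then show ?thesis by blast
qed

text \<open>Exchanging \<open>x\<close> and \<open>y\<close> gives a second expression for the same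
  vector; independence of \<open>g x\<close> and \<open>g y\<close> makes both coefficients
  1.\<close>

lemma g_add_independent:
  assumes x: "ip x e = 0" "x \<noteq> 0" and y: "ip y e = 0" and indep: "\<And>c. y \<noteq> s c x"
  shows "g (x + y) = g x + g y"
proof -
  have "y \<noteq> 0" using indep[of 0] by auto
  then obtain b where b: "g (x + y) = g x + s b (g y)" using g_add_coplanar x y by blast
  obtain c where c: "g (y + x) = g y + s c (g x)" using g_add_coplanar x y by blast
  have "g x + s b (g y) = g y + s c (g x)" using b c by (simp add: add.commute)
  then have "s (1 - c) (g x) = s (1 - b) (g y)"
    by (simp add: scale_left_diff_distrib algebra_simps)
  then have "1 - b = 0" using g_independent x y indep by blast
  then show ?thesis using b by simp
qed

lemma orthogonal_independent:
  assumes "x \<noteq> 0" "z \<noteq> 0" "ip z x = 0"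
  shows "z \<noteq> s c x"
  using assms by (auto simp: ip_simps ip_eq_zero_iff)

text \<open>For dependent \<open>x\<close> and \<open>y\<close>, an auxiliary \<open>z\<close>
  orthogonal to \<open>e\<close> and \<open>x\<close> makes the sums independent;
  \<open>g (x + y + z)\<close> is expanded in two ways and \<open>g z\<close> cancelled.\<close>

lemma g_add:
  assumes x: "ip x e = 0" and y: "ip y e = 0"
  shows "g (x + y) = g x + g y"
proof (cases "x = 0 \<or> y = 0 \<or> (\<forall>c. y \<noteq> s c x)")
  case True
  then show ?thesis using g_add_independent[OF x _ y] g_0 by fastforce
next
  case False
  then obtain c where c: "y = s c x" and nz: "x \<noteq> 0" "y \<noteq> 0" by blast
  obtain z where z: "z \<noteq> 0" "ip z e = 0" "ip z x = 0" using exists_orthogonal by blast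
  have zy: "ip z y = 0" using z c by (simp add: ip_simps)
  have yz: "ip (y + z) e = 0" using y z by (simp add: ip_simps)
  have ne: "y + z \<noteq> s d x" for d
  proof
    assume "y + z = s d x"
    then have "z = s (d - c) x" using c by (simp add: scale_left_diff_distrib algebra_simps)
    then show False using orthogonal_independent nz z by blast
  qed
  have "g (x + (y + z)) = g x + g (y + z)" using g_add_independent[OF x nz(1) yz ne] .
  also have "g (y + z) = g y + g z"
    using g_add_independent[OF y nz(2) z(2)] orthogonal_independent nz z zy by blast
  finally have 1: "g (x + y + z) = g x + g y + g z" by (simp add: add.assoc)
  have xy: "ip (x + y) e = 0" "ip z (x + y) = 0" using x y z zy by (simp_all add: ip_simps)
  have "g (x + y + z) = g (x + y) + g z"
  proof (cases "x + y = 0")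
    case False
    then show ?thesis
      using g_add_independent[OF xy(1) False z(2)] orthogonal_independent z xy by blast
  qed (simp add: g_0)
  with 1 show ?thesis by simp
qed

section \<open>Semilinearity of \<open>g\<close>\<close>

lemma g_scale_exists:
  assumes x: "ip x e = 0"
  shows "\<exists>t. g (s a x) = s t (g x)"
proof (cases "x = 0 \<or> a = 0")
  case True
  then show ?thesis using g_0 by (metis scale_zero_left scale_zero_right)
next
  case False
  then have "R (s a x) (g x)" using R_scale_left R_g x by blast
  moreover have "R (s a x) (g (s a x))" using False x by (intro R_g) (auto simp: ip_simps)
  ultimately show ?thesis using R_collinear by blast
qed

text \<open>The factor \<open>u\<close> belonging to \<open>x + y\<close> must agree with the
  factors of both \<open>x\<close> and \<open>y\<close>, because \<open>g x\<close> and
  \<open>g y\<close> are independent.\<close>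

lemma g_scale_independent:
  assumes x: "ip x e = 0" "x \<noteq> 0" and y: "ip y e = 0" and indep: "\<And>c. y \<noteq> s c x"
    and t: "g (s a x) = s t (g x)"
  shows "g (s a y) = s t (g y)"
proof -
  obtain t' where t': "g (s a y) = s t' (g y)" using g_scale_exists y by blast
  have xy: "ip (x + y) e = 0" using x y by (simp add: ip_simps)
  then obtain u where "g (s a (x + y)) = s u (g (x + y))" using g_scale_exists by blast
  then have "s u (g x) + s u (g y) = g (s a x + s a y)"
    using g_add x y by (simp add: scale_right_distrib)
  also have "\<dots> = s t (g x) + s t' (g y)"
    using x y t t' by (subst g_add) (auto simp: ip_simps)
  finally have "s (u - t) (g x) = s (t' - u) (g y)"
    by (simp add: scale_left_diff_distrib algebra_simps)
  then have "u - t = 0 \<and> t' - u = 0" using g_independent x y indep by blast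
  then show ?thesis using t' by simp
qed

text \<open>The factor found at \<open>x0\<close> passes to every vector independent of
  \<open>x0\<close>, in particular to an orthogonal \<open>z\<close>; from \<open>z\<close> it
  returns to the multiples of \<open>x0\<close>.\<close>

lemma g_semilinear_scalar: "\<exists>t. \<forall>x. ip x e = 0 \<longrightarrow> g (s a x) = s t (g x)"
proof -
  obtain x0 where x0: "x0 \<noteq> 0" "ip x0 e = 0" using exists_orthogonal by blast
  obtain t where t: "g (s a x0) = s t (g x0)" using g_scale_exists x0 by blast
  obtain z where z: "z \<noteq> 0" "ip z e = 0" "ip z x0 = 0" using exists_orthogonal by blast
  have tz: "g (s a z) = s t (g z)"
    using g_scale_independent[OF x0(2,1) z(2) _ t] orthogonal_independent x0 z by blast
  have "g (s a x) = s t (g x)" if x: "ip x e = 0" for x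
  proof (cases "\<exists>c. x = s c x0")
    case False
    then show ?thesis using g_scale_independent[OF x0(2,1) x _ t] by blast
  next
    case True
    then have xz: "ip x z = 0" using z ip_zero_commute[of x0 z] by (auto simp: ip_simps)
    show ?thesis
    proof (cases "x = 0")
      case False
      then show ?thesis
        using g_scale_independent[OF z(2,1) x _ tz] orthogonal_independent xz z by blast
    qed (simp add: g_0)
  qed
  then show ?thesis by blast
qed

definition \<sigma> :: "'k \<Rightarrow> 'k" where
  "\<sigma> a = (SOME t. \<forall>x. ip x e = 0 \<longrightarrow> g (s a x) = s t (g x))"

lemma g_scale: "ip x e = 0 \<Longrightarrow> g (s a x) = s (\<sigma> a) (g x)"
  using someI_ex[OF g_semilinear_scalar[of a]] unfolding \<sigma>_def by blast

text \<open>Some value of \<open>g\<close> is nonzero, so scalars are determined by their action on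
  values of \<open>g\<close>. In particular the choice made in \<open>\<sigma>\<close> is the only
  one possible.\<close>

lemma \<sigma>_eqI:
  assumes "\<And>x. ip x e = 0 \<Longrightarrow> s a (g x) = s b (g x)"
  shows "a = b"
proof -
  obtain x where "x \<noteq> 0" "ip x e = 0" using exists_orthogonal by blast
  then show ?thesis using assms[of x] g_nonzero[of x] by simp
qed

lemma \<sigma>_add: "\<sigma> (a + b) = \<sigma> a + \<sigma> b"
proof (rule \<sigma>_eqI)
  fix x assume x: "ip x e = 0"
  have "s (\<sigma> (a + b)) (g x) = g (s a x + s b x)"
    using g_scale[OF x, of "a + b"] by (simp add: scale_left_distrib)
  also have "\<dots> = g (s a x) + g (s b x)" using x by (intro g_add) (simp_all add: ip_simps)
  finally show "s (\<sigma> (a + b)) (g x) = s (\<sigma> a + \<sigma> b) (g x)"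
    using x by (simp add: g_scale scale_left_distrib)
qed

lemma \<sigma>_mult: "\<sigma> (a * b) = \<sigma> a * \<sigma> b"
proof (rule \<sigma>_eqI)
  fix x assume x: "ip x e = 0"
  have "s (\<sigma> (a * b)) (g x) = g (s a (s b x))" using g_scale[OF x, of "a * b"] by simp
  also have "\<dots> = s (\<sigma> a) (g (s b x))" using x by (intro g_scale) (simp add: ip_simps)
  finally show "s (\<sigma> (a * b)) (g x) = s (\<sigma> a * \<sigma> b) (g x)" using x by (simp add: g_scale)
qed

lemma \<sigma>_1: "\<sigma> 1 = 1"
  using g_scale[of _ 1] by (intro \<sigma>_eqI) simp

lemma \<sigma>_0: "\<sigma> 0 = 0"
  by (metis \<sigma>_add add.right_neutral add_left_cancel)

lemma \<sigma>_minus: "\<sigma> (- a) = - \<sigma> a"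
  using \<sigma>_add[of a "- a"] \<sigma>_0 by (simp add: add_eq_0_iff)

lemma \<sigma>_inverse: "a \<noteq> 0 \<Longrightarrow> \<sigma> a * \<sigma> (inverse a) = 1"
  by (metis \<sigma>_1 \<sigma>_mult right_inverse)

lemma \<sigma>_nonzero: "a \<noteq> 0 \<Longrightarrow> \<sigma> a \<noteq> 0"
  using \<sigma>_inverse by fastforce

section \<open>Inner products under \<open>g\<close>\<close>

lemma ip_g_minus_one:
  assumes x: "ip x e = 0" and y: "ip y e = 0" and xy: "ip x y = - 1"
  shows "ip (g x) (g y) = - 1"
proof -
  have "ip (e + x) (e + y) = 0"
    using assms ip_zero_commute[of y e] by (simp add: ip_simps ip_e)
  then have "ip (e' + g x) (e' + g y) = 0"
    using R_orthogonal[OF R_add_g[OF x] R_add_g[OF y]] by simp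
  then show ?thesis
    using ip_g_e'[OF x] ip_g_e'[OF y] ip_zero_commute[of "g y" e']
    by (simp add: ip_simps ip_e' add_eq_0_iff)
qed

text \<open>A nonzero product \<open>m\<close> is brought to -1 by the factor
  \<open>- inverse m\<close>, which \<open>g\<close> turns into
  \<open>- \<sigma> (inverse m)\<close>; a zero product is plain orthogonality.\<close>

lemma ip_g:
  assumes x: "ip x e = 0" and y: "ip y e = 0"
  shows "ip (g x) (g y) = \<sigma> (ip x y)"
proof (cases "ip x y = 0")
  case True
  show ?thesis
  proof (cases "x = 0 \<or> y = 0")
    case False
    then show ?thesis using R_orthogonal[OF R_g[OF x] R_g[OF y]] True by (simp add: \<sigma>_0)
  qed (auto simp: g_0 ip_simps \<sigma>_0)
next
  case False
  define m where "m = ip x y"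
  have "ip (s (- inverse m) x) y = - 1" using False by (simp add: ip_simps m_def)
  moreover have "ip (s (- inverse m) x) e = 0" using x by (simp add: ip_simps)
  ultimately have "ip (g (s (- inverse m) x)) (g y) = - 1" using ip_g_minus_one y by blast
  then have 1: "\<sigma> (inverse m) * ip (g x) (g y) = 1"
    unfolding g_scale[OF x] by (simp add: ip_simps \<sigma>_minus)
  have "\<sigma> m * \<sigma> (inverse m) = 1" using \<sigma>_inverse False m_def by simp
  then have "ip (g x) (g y) = \<sigma> m * \<sigma> (inverse m) * ip (g x) (g y)" by simp
  also have "\<dots> = \<sigma> m" by (simp only: mult.assoc 1 mult.right_neutral)
  finally show ?thesis by (simp add: m_def)
qed

text \<open>For a unit vector \<open>x\<close>, the products of \<open>x\<close> and
  \<open>s a x\<close> in the two orders are \<open>J a\<close> and \<open>a\<close>;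
  \<open>ip_g\<close> and \<open>ip_commute\<close> compare their images.\<close>

lemma \<sigma>_J: "\<sigma> (J a) = J (\<sigma> a)"
proof -
  obtain x0 where x0: "x0 \<noteq> 0" "ip x0 e = 0" using exists_orthogonal by blast
  obtain c where c: "ip (s c x0) (s c x0) = 1" using unit_multiple x0 by blast
  define x where "x = s c x0"
  have x: "ip x e = 0" "ip x x = 1" using x0 c by (simp_all add: x_def ip_simps)
  have ax: "ip (s a x) e = 0" using x by (simp add: ip_simps)
  have "ip (g x) (g (s a x)) = \<sigma> (J a)" using ip_g[OF x(1) ax] x by (simp add: ip_simps)
  moreover have "ip (g (s a x)) (g x) = \<sigma> a" using ip_g[OF ax x(1)] x by (simp add: ip_simps)
  ultimately show ?thesis using ip_commute[of "g x" "g (s a x)"] by simp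
qed

section \<open>Extension of \<open>g\<close> to the whole space\<close>

definition U :: "'a \<Rightarrow> 'a" where
  "U v = s (\<sigma> (ip v e)) e' + g (v - s (ip v e) e)"

lemma ip_perp_part: "ip (v - s (ip v e) e) e = 0"
  by (simp add: ip_simps ip_e)

lemma U_add: "U (v + w) = U v + U w"
proof -
  have "v + w - s (ip (v + w) e) e = (v - s (ip v e) e) + (w - s (ip w e) e)"
    by (simp add: ip_simps scale_left_distrib)
  then have "g (v + w - s (ip (v + w) e) e) = g (v - s (ip v e) e) + g (w - s (ip w e) e)"
    using g_add ip_perp_part by metis
  then show ?thesis by (simp add: U_def ip_add_left \<sigma>_add scale_left_distrib)
qed

lemma U_scale: "U (s a v) = s (\<sigma> a) (U v)"
proof -
  have "s a v - s (ip (s a v) e) e = s a (v - s (ip v e) e)"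
    by (simp add: ip_simps scale_right_diff_distrib)
  then have "g (s a v - s (ip (s a v) e) e) = s (\<sigma> a) (g (v - s (ip v e) e))"
    using g_scale ip_perp_part by metis
  then show ?thesis by (simp add: U_def ip_scale_left \<sigma>_mult scale_right_distrib)
qed

text \<open>Cross terms vanish in both decompositions; \<open>\<sigma>_J\<close> handles the
  coefficient that the second argument conjugates.\<close>

lemma ip_U: "ip (U v) (U w) = \<sigma> (ip v w)"
proof -
  define x where "x = v - s (ip v e) e"
  define y where "y = w - s (ip w e) e"
  have x: "ip x e = 0" and y: "ip y e = 0" unfolding x_def y_def by (rule ip_perp_part)+
  have v: "v = s (ip v e) e + x" and w: "w = s (ip w e) e + y" by (simp_all add: x_def y_def)
  have "ip v w = ip v e * J (ip w e) + ip x y"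
    using x y ip_zero_commute[of y e]
    by (subst v, subst w) (simp add: ip_add_left ip_add_right ip_scale_left ip_scale_right ip_e)
  moreover have "ip (U v) (U w) = \<sigma> (ip v e) * J (\<sigma> (ip w e)) + ip (g x) (g y)"
    using ip_g_e'[OF x] ip_g_e'[OF y] ip_zero_commute[of "g y" e']
    unfolding U_def x_def[symmetric] y_def[symmetric] by (simp add: ip_simps ip_e')
  ultimately show ?thesis by (simp add: \<sigma>_add \<sigma>_mult \<sigma>_J ip_g[OF x y])
qed

lemma R_U:
  assumes "v \<noteq> 0"
  shows "R v (U v)"
proof (cases "ip v e = 0")
  case True
  then show ?thesis using R_g assms by (simp add: U_def \<sigma>_0)
next
  case False
  define a where "a = ip v e"
  define x where "x = v - s a e"
  have x: "ip x e = 0" unfolding x_def a_def by (rule ip_perp_part)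
  have a: "a \<noteq> 0" using False a_def by simp
  have "ip (s (inverse a) x) e = 0" using x by (simp add: ip_simps)
  then have "R (e + s (inverse a) x) (e' + g (s (inverse a) x))" by (rule R_add_g)
  \<comment> \<open>Dividing \<open>v\<close> by its component \<open>a\<close> moves it into the
    chart \<open>e + x\<close>; multiplying back changes no line, since \<open>a\<close> and
    \<open>\<sigma> a\<close> are nonzero.\<close>
  then have "R (s a (e + s (inverse a) x)) (s (\<sigma> a) (e' + g (s (inverse a) x)))"
    using R_scale_left R_scale_right a \<sigma>_nonzero by blast
  moreover have "s a (e + s (inverse a) x) = v" using a by (simp add: scale_right_distrib x_def)
  moreover have "s (\<sigma> a) (e' + g (s (inverse a) x)) = U v"
    using a x unfolding U_def a_def[symmetric] x_def[symmetric]
    by (simp add: g_scale scale_right_distrib \<sigma>_inverse)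
  ultimately show ?thesis by simp
qed

end

text \<open>The outcome common to both fields. The last conjunct keeps a scalar outside
  \<open>U\<close>, because surjectivity of \<open>U\<close> itself also needs surjectivity of
  \<open>\<sigma>\<close>, which is settled for each field separately.\<close>

lemma (in orthogonality_relation) semilinear_realization:
  "\<exists>\<sigma> U. (\<forall>a b. \<sigma> (a + b) = \<sigma> a + \<sigma> b) \<and> (\<forall>a b. \<sigma> (a * b) = \<sigma> a * \<sigma> b) \<and> \<sigma> 1 = 1 \<and>
     (\<forall>a. \<sigma> (J a) = J (\<sigma> a)) \<and> (\<forall>v w. U (v + w) = U v + U w) \<and>
     (\<forall>a v. U (s a v) = s (\<sigma> a) (U v)) \<and> (\<forall>v w. ip (U v) (U w) = \<sigma> (ip v w)) \<and>
     (\<forall>v. v \<noteq> 0 \<longrightarrow> R v (U v)) \<and> (\<forall>w. \<exists>c v. w = s c (U v))"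
proof -
  obtain u :: 'a where "u \<noteq> 0" using exists_orthogonal by blast
  then obtain c where c: "ip (s c u) (s c u) = 1" using unit_multiple by blast
  then have "s c u \<noteq> 0" by (auto simp: ip_zero_left)
  then obtain w where w: "R (s c u) w" using R_total by blast
  then obtain d where d: "ip (s d w) (s d w) = 1" using unit_multiple R_nonzero by blast
  then have "d \<noteq> 0" by (auto simp: ip_zero_left)
  then interpret based_orthogonality_relation s J ip R "s c u" "s d w"
    using R_scale_right[OF w] c d by unfold_locales
  have "\<exists>c v. w = s c (U v)" for w
  proof (cases "w = 0")
    case True
    then have "w = s 0 (U 0)" by simp
    then show ?thesis by blast
  next
    case False
    then obtain v where "R v w" using R_surj by blast
    then show ?thesis using R_collinear R_U R_nonzero by blast
  qed
  then show ?thesis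
    by (intro exI[of _ \<sigma>] exI[of _ U] conjI allI impI)
      (rule \<sigma>_add \<sigma>_mult \<sigma>_1 \<sigma>_J U_add U_scale ip_U R_U | assumption)+
qed

section \<open>From lines to vectors\<close>

lemma (in vector_space) line_scale: "c \<noteq> 0 \<Longrightarrow> line scale (scale c v) = line scale v"
  unfolding line_def by (simp add: span_image_scale[of "{v}" "\<lambda>_. c", simplified])

lemma (in hermitian_space) orthogonality_relation_lines:
  assumes dim: "3 \<le> space_dim s"
    and bij: "bij_betw \<phi> (lines s) (lines s)"
    and perp: "\<forall>L \<in> lines s. \<forall>M \<in> lines s.
      line_perp s ip L M \<longleftrightarrow> line_perp s ip (\<phi> L) (\<phi> M)"
    and perp_iff: "\<And>u v. u \<noteq> 0 \<Longrightarrow> v \<noteq> 0 \<Longrightarrow>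
      line_perp s ip (line s u) (line s v) \<longleftrightarrow> ip u v = 0"
  shows "orthogonality_relation s J ip (\<lambda>v w. v \<noteq> 0 \<and> w \<noteq> 0 \<and> \<phi> (line s v) = line s w)"
proof -
  have lines: "lines s = {line s v | v. v \<noteq> 0}" by (rule lines_eq) (rule vector_space_axioms)
  show ?thesis
  proof (unfold_locales, goal_cases)
    \<comment> \<open>Goals 1, 3, 4 and 7 are \<open>exists_orthogonal\<close>,
      \<open>R_total\<close>, \<open>R_surj\<close> and \<open>R_orthogonal\<close>; the others
      reduce to rescaling a generator.\<close>
    case (1 u v)
    then show ?case using exists_orthogonal_to_pair[OF dim] .
  next
    case (3 v)
    then have "\<phi> (line s v) \<in> lines s" using bij_betwE[OF bij] lines by blast
    then show ?case using 3 unfolding lines by blast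
  next
    case (4 w)
    then have "line s w \<in> \<phi> ` lines s" using bij_betw_imp_surj_on[OF bij] lines by blast
    then show ?case using 4 unfolding lines by force
  next
    case (7 v w v' w')
    then have "line s v \<in> lines s" "line s v' \<in> lines s" using lines by blast+
    then show ?case using 7 perp perp_iff by metis
  qed (auto simp: line_scale)
qed

section \<open>Endomorphisms of the scalars\<close>

text \<open>Rationals are fixed, and squares go to squares, so \<open>f\<close> is monotone; a
  rational strictly between \<open>x\<close> and \<open>f x\<close> would contradict this.\<close>

lemma real_ring_endomorphism_id:
  fixes f :: "real \<Rightarrow> real"
  assumes add: "\<And>x y. f (x + y) = f x + f y" and mult: "\<And>x y. f (x * y) = f x * f y"
    and one: "f 1 = 1"
  shows "f x = x"
proof -
  have f0: "f 0 = 0" using add[of 0 0] by simp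
  have minus: "f (- x) = - f x" for x using add[of x "- x"] f0 by simp
  have nat: "f (real n) = real n" for n by (induction n) (auto simp: f0 add one)
  have int: "f (of_int k) = of_int k" for k
    by (cases k rule: int_cases2) (auto simp: nat minus)
  have rat: "f q = q" if "q \<in> \<rat>" for q
  proof -
    from that obtain m n where q: "n > 0" "q = of_int m / of_int n" by (rule Rats_cases')
    then have "q * of_int n = of_int m" by simp
    then have "f q * of_int n = q * of_int n" using mult[of q "of_int n"] int by auto
    then show ?thesis using q(1) by simp
  qed
  have mono: "f x \<le> f y" if "x \<le> y" for x y
  proof -
    have "f (y - x) = f (sqrt (y - x)) * f (sqrt (y - x))"
      using that mult[of "sqrt (y - x)" "sqrt (y - x)"] by simp
    then have "0 \<le> f (y - x)" by simp
    moreover have "f y = f x + f (y - x)" using add[of x "y - x"] by simp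
    ultimately show ?thesis by simp
  qed
  show ?thesis
  proof (rule ccontr)
    assume "f x \<noteq> x"
    then consider "f x < x" | "x < f x" by linarith
    then show False
    proof cases
      case 1
      then obtain q where "q \<in> \<rat>" "f x < q" "q < x" using Rats_dense_in_real by blast
      then show False using mono[of q x] rat[of q] by simp
    next
      case 2
      then obtain q where "q \<in> \<rat>" "x < q" "q < f x" using Rats_dense_in_real by blast
      then show False using mono[of x q] rat[of q] by simp
    qed
  qed
qed

text \<open>Commuting with \<open>cnj\<close> makes \<open>f\<close> map reals to reals, hence fix
  them by the real case; what remains is the choice of a square root of -1 for
  \<open>f \<i>\<close>.\<close>

lemma complex_ring_endomorphism_cnj:
  fixes f :: "complex \<Rightarrow> complex"
  assumes add: "\<And>x y. f (x + y) = f x + f y" and mult: "\<And>x y. f (x * y) = f x * f y"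
    and one: "f 1 = 1" and cnj: "\<And>x. f (cnj x) = cnj (f x)"
  shows "f = id \<or> f = cnj"
proof -
  have "cnj (f (of_real r)) = f (of_real r)" for r using cnj[of "of_real r"] by simp
  then have "f (of_real r) \<in> \<real>" for r by (simp add: Reals_cnj_iff)
  then have Re: "f (of_real r) = of_real (Re (f (of_real r)))" for r by simp
  have "Re (f (of_real r)) = r" for r
  proof (rule real_ring_endomorphism_id)
    show "Re (f (of_real (x * y))) = Re (f (of_real x)) * Re (f (of_real y))" for x y
      using Re by (metis Re_complex_of_real mult of_real_mult)
  qed (simp_all add: add one)
  then have real: "f (of_real r) = of_real r" for r using Re by simp
  have "f \<i> * f \<i> = - 1" using mult[of \<i> \<i>] real[of "- 1"] by simp
  then have "(f \<i> - \<i>) * (f \<i> + \<i>) = 0" by (simp add: algebra_simps)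
  then consider "f \<i> = \<i>" | "f \<i> = - \<i>" by (auto simp: add_eq_0_iff2)
  moreover have "f z = of_real (Re z) + f \<i> * of_real (Im z)" for z
    using complex_eq[of z] real by (metis add mult)
  ultimately show ?thesis by cases (auto simp: fun_eq_iff complex_eq_iff)
qed

section \<open>The Wigner symmetry\<close>

lemma bij_isometryI:
  fixes U :: "'a::real_normed_vector \<Rightarrow> 'a"
  assumes add: "\<And>v w. U (v + w) = U v + U w" and norm: "\<And>v. norm (U v) = norm v"
    and surj: "surj U"
  shows "bij U \<and> isometry U"
proof -
  have "U v - U w = U (v - w)" for v w using add[of "v - w" w] by simp
  then have iso: "dist (U v) (U w) = dist v w" for v w by (simp add: dist_norm norm)
  then have "inj U" by (metis dist_eq_0_iff injI)
  with surj iso show ?thesis by (simp add: bij_def isometry_def)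
qed

lemma hermitian_space_real:
  "hermitian_space (scaleR :: real \<Rightarrow> 'a::real_inner \<Rightarrow> 'a) (\<lambda>x. x) inner"
proof (unfold_locales, goal_cases)
  \<comment> \<open>The goal \<open>unit_multiple\<close>, met by normalising
    \<open>x\<close>.\<close>
  case (8 x)
  then show ?case by (intro exI[of _ "1 / norm x"]) (simp add: dot_square_norm power2_eq_square)
qed (auto simp: inner_commute inner_add_left inner_add_right)

lemma cinner_self: "cinner x x = complex_of_real ((norm x)\<^sup>2)" for x :: "'a::complex_inner"
proof -
  have "Im (cinner x x) = 0" using cinner_commute[of x x] by (simp add: complex_eq_iff)
  then show ?thesis by (simp add: complex_eq_iff norm_eq_sqrt_cinner cinner_ge_zero)
qed

lemma hermitian_space_complex:
  "hermitian_space (scaleC :: complex \<Rightarrow> 'a::complex_inner \<Rightarrow> 'a) cnj cinner"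
proof (intro hermitian_space.intro vector_space_scaleC, unfold_locales, goal_cases)
  case (8 x)
  then show ?case
    by (intro exI[of _ "complex_of_real (1 / norm x)"])
      (simp add: cinner_scaleC_left cinner_scaleC_right cinner_self[of x] power2_eq_square)
qed (auto simp: cinner_commute[symmetric] cinner_add_left cinner_scaleC_left cinner_eq_zero_iff)

theorem lemma3p8:
  shows "(\<forall>\<phi> :: 'r::real_inner set \<Rightarrow> 'r set.
            3 \<le> space_dim (scaleR :: real \<Rightarrow> 'r \<Rightarrow> 'r) \<longrightarrow>
            bij_betw \<phi> (lines scaleR) (lines scaleR) \<longrightarrow>
            (\<forall>L \<in> lines scaleR. \<forall>M \<in> lines scaleR.
               line_perp scaleR inner L M \<longleftrightarrow> line_perp scaleR inner (\<phi> L) (\<phi> M)) \<longrightarrow>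
            real_Wigner_symmetry \<phi>)
       \<and> (\<forall>\<phi> :: 'c::complex_inner set \<Rightarrow> 'c set.
            3 \<le> space_dim (scaleC :: complex \<Rightarrow> 'c \<Rightarrow> 'c) \<longrightarrow>
            bij_betw \<phi> (lines scaleC) (lines scaleC) \<longrightarrow>
            (\<forall>L \<in> lines scaleC. \<forall>M \<in> lines scaleC.
               line_perp scaleC cinner L M \<longleftrightarrow> line_perp scaleC cinner (\<phi> L) (\<phi> M)) \<longrightarrow>
            complex_Wigner_symmetry \<phi>)"
proof (intro conjI allI impI, goal_cases)
  case (1 \<phi>)
  interpret hermitian_space "scaleR :: real \<Rightarrow> 'r \<Rightarrow> 'r" "\<lambda>x. x" inner
    by (rule hermitian_space_real)
  interpret orthogonality_relation "scaleR :: real \<Rightarrow> 'r \<Rightarrow> 'r" "\<lambda>x. x" inner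
      "\<lambda>v w. v \<noteq> 0 \<and> w \<noteq> 0 \<and> \<phi> (line scaleR v) = line scaleR w"
    using 1 by (rule orthogonality_relation_lines) (rule line_perp_line_real)
  obtain \<sigma> and U :: "'r \<Rightarrow> 'r" where \<sigma>: "\<And>a b. \<sigma> (a + b) = \<sigma> a + \<sigma> b"
      "\<And>a b. \<sigma> (a * b) = \<sigma> a * \<sigma> b" "\<sigma> 1 = 1"
    and add: "\<And>v w. U (v + w) = U v + U w" and scale: "\<And>a v. U (a *\<^sub>R v) = \<sigma> a *\<^sub>R U v"
    and ip: "\<And>v w. inner (U v) (U w) = \<sigma> (inner v w)"
    and R: "\<And>v. v \<noteq> 0 \<Longrightarrow> U v \<noteq> 0 \<and> \<phi> (line scaleR v) = line scaleR (U v)"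
    and span: "\<And>w. \<exists>c v. w = c *\<^sub>R U v"
    using semilinear_realization by blast
  have id: "\<sigma> a = a" for a using real_ring_endomorphism_id \<sigma> by blast
  have "\<exists>v. w = U v" for w
  proof -
    obtain c v where "w = c *\<^sub>R U v" using span by blast
    moreover obtain a where "\<sigma> a = c" using id by blast
    ultimately have "w = U (a *\<^sub>R v)" using scale by simp
    then show ?thesis by blast
  qed
  then have "surj U" by (simp add: surj_def)
  then have "bij U \<and> isometry U"
    using add ip id by (intro bij_isometryI) (auto simp: norm_eq_sqrt_inner)
  moreover have "linear U" using add scale id by (intro linearI) auto
  ultimately show ?case unfolding real_Wigner_symmetry_def using R by blast
next
  case (2 \<phi>)
  interpret hermitian_space "scaleC :: complex \<Rightarrow> 'c \<Rightarrow> 'c" cnj cinner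
    by (rule hermitian_space_complex)
  interpret orthogonality_relation "scaleC :: complex \<Rightarrow> 'c \<Rightarrow> 'c" cnj cinner
      "\<lambda>v w. v \<noteq> 0 \<and> w \<noteq> 0 \<and> \<phi> (line scaleC v) = line scaleC w"
    using 2 by (rule orthogonality_relation_lines) (rule line_perp_line_complex)
  obtain \<sigma> and U :: "'c \<Rightarrow> 'c" where \<sigma>: "\<And>a b. \<sigma> (a + b) = \<sigma> a + \<sigma> b"
      "\<And>a b. \<sigma> (a * b) = \<sigma> a * \<sigma> b" "\<sigma> 1 = 1" "\<And>a. \<sigma> (cnj a) = cnj (\<sigma> a)"
    and add: "\<And>v w. U (v + w) = U v + U w" and scale: "\<And>a v. U (a *\<^sub>C v) = \<sigma> a *\<^sub>C U v"
    and ip: "\<And>v w. cinner (U v) (U w) = \<sigma> (cinner v w)"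
    and R: "\<And>v. v \<noteq> 0 \<Longrightarrow> U v \<noteq> 0 \<and> \<phi> (line scaleC v) = line scaleC (U v)"
    and span: "\<And>w. \<exists>c v. w = c *\<^sub>C U v"
    using semilinear_realization by blast
  have id: "\<sigma> = id \<or> \<sigma> = cnj" using complex_ring_endomorphism_cnj \<sigma> by blast
  \<comment> \<open>Surjectivity of \<open>\<sigma>\<close> lets the outer scalar be absorbed into
    the argument of \<open>U\<close>.\<close>
  then have \<sigma>_surj: "\<exists>a. \<sigma> a = c" for c by (metis complex_cnj_cnj id_apply)
  have "\<exists>v. w = U v" for w
  proof -
    obtain c v where "w = c *\<^sub>C U v" using span by blast
    moreover obtain a where "\<sigma> a = c" using \<sigma>_surj by blast
    ultimately have "w = U (a *\<^sub>C v)" using scale by simp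
    then show ?thesis by blast
  qed
  then have "surj U" by (simp add: surj_def)
  \<comment> \<open>The norm depends only on the real part of \<open>cinner v v\<close>, which both
    \<open>id\<close> and \<open>cnj\<close> preserve.\<close>
  moreover have "norm (U v) = norm v" for v
    using ip[of v v] id by (auto simp: norm_eq_sqrt_cinner)
  ultimately have "bij U \<and> isometry U" using add by (intro bij_isometryI) auto
  moreover have "Vector_Spaces.linear scaleC scaleC U \<or> conjugate_linear U"
    using id
  proof
    assume "\<sigma> = id"
    then have "Vector_Spaces.linear scaleC scaleC U"
      using add scale by unfold_locales simp_all
    then show ?thesis ..
  next
    assume "\<sigma> = cnj"
    then have "conjugate_linear U" using add scale by (simp add: conjugate_linear_def)
    then show ?thesis ..
  qed
  ultimately show ?case unfolding complex_Wigner_symmetry_def using R by blast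
qed

end
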